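(* Fix an environment, i.e. a deterministic sequence $(p_t,\alpha_t)_{t\ge 1}$ in $(0,1)^2$, and let $\beta_t=1-\alpha_t$. Let $(N_t)_{t\ge 0}$ be the Galton–Watson process with $N_0=1$ in this environment, where each particle of generation $t-1$ independently has $k$ offspring with probability $\alpha_t$ if $k=0$ and $(1-\alpha_t)p_t(1-p_t)^{k-1}$ if $k\ge 1$. For $t\ge 1$ put $$S_t=1+\sum_{i=1}^{t}\frac{1-\beta_i}{\beta_i}\prod_{j=1}^{i-1}\frac{p_j}{\beta_j},\qquad \pi(t)=1-\frac1{S_t},\qquad \rho(t)=\frac{1}{S_t}\prod_{i=1}^t\frac{p_i}{\beta_i}.$$ Then for every $t\ge 1$ and every $k\ge 1$, $$P(N_t=k)=(1-\pi(t))\,\rho(t)\,(1-\rho(t))^{k-1}.$$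
   Context: $P$ denotes the quenched probability, i.e. the law of $(N_t)$ for the given fixed environment. The process satisfies $N_t=\sum_{i=1}^{N_{t-1}}\xi_{t,i}$, where all $\xi_{t,i}$ ($t,i\ge1$) are independent and $P(\xi_{t,i}=0)=\alpha_t$, $P(\xi_{t,i}=k)=(1-\alpha_t)p_t(1-p_t)^{k-1}$ for $k\ge1$. Empty products equal $1$. In the paper $\pi(t)$ is the extinction probability $P(N_t=0)$, which equals $1-1/S_t$. *)

theory Defs
  imports "HOL-Probability.Probability"
begin

text \<open>
  An environment is a pair of sequences \<open>p, \<alpha>\<close>; all sequences are indexed from 1 on and their
  value at index 0 is never used. The family \<open>\<xi> t i\<close> is the number of offspring of the \<open>i\<close>-th
  particle of generation \<open>t - 1\<close>.
\<close>

definition offspring_prob :: "(nat \<Rightarrow> real) \<Rightarrow> (nat \<Rightarrow> real) \<Rightarrow> nat \<Rightarrow> nat \<Rightarrow> real" where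
  "offspring_prob p \<alpha> t k = (if k = 0 then \<alpha> t else (1 - \<alpha> t) * p t * (1 - p t) ^ (k - 1))"

definition offspring_family ::
  "'a measure \<Rightarrow> (nat \<Rightarrow> real) \<Rightarrow> (nat \<Rightarrow> real) \<Rightarrow> (nat \<Rightarrow> nat \<Rightarrow> 'a \<Rightarrow> nat) \<Rightarrow> bool" where
  "offspring_family M p \<alpha> \<xi> \<longleftrightarrow>
     prob_space.indep_vars M (\<lambda>_. count_space UNIV) (\<lambda>(t, i). \<xi> t i) ({1..} \<times> {1..}) \<and>
     (\<forall>t\<ge>1. \<forall>i\<ge>1. \<forall>k. \<P>(\<omega> in M. \<xi> t i \<omega> = k) = offspring_prob p \<alpha> t k)"

primrec gw_process :: "(nat \<Rightarrow> nat \<Rightarrow> 'a \<Rightarrow> nat) \<Rightarrow> nat \<Rightarrow> 'a \<Rightarrow> nat" where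
  "gw_process \<xi> 0 \<omega> = 1"
| "gw_process \<xi> (Suc t) \<omega> = (\<Sum>i = 1..gw_process \<xi> t \<omega>. \<xi> (Suc t) i \<omega>)"

definition beta :: "(nat \<Rightarrow> real) \<Rightarrow> nat \<Rightarrow> real" where
  "beta \<alpha> t = 1 - \<alpha> t"

definition S_env :: "(nat \<Rightarrow> real) \<Rightarrow> (nat \<Rightarrow> real) \<Rightarrow> nat \<Rightarrow> real" where
  "S_env p \<alpha> t =
     1 + (\<Sum>i = 1..t. (1 - beta \<alpha> i) / beta \<alpha> i * (\<Prod>j = 1..<i. p j / beta \<alpha> j))"

definition pi_env :: "(nat \<Rightarrow> real) \<Rightarrow> (nat \<Rightarrow> real) \<Rightarrow> nat \<Rightarrow> real" where
  "pi_env p \<alpha> t = 1 - 1 / S_env p \<alpha> t"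

definition rho_env :: "(nat \<Rightarrow> real) \<Rightarrow> (nat \<Rightarrow> real) \<Rightarrow> nat \<Rightarrow> real" where
  "rho_env p \<alpha> t = 1 / S_env p \<alpha> t * (\<Prod>i = 1..t. p i / beta \<alpha> i)"

end

theory Submission
  imports Defs
begin

text \<open>
  For a linear fractional generating function \<open>f\<close>, the map \<open>1 / (1 - f z)\<close> is an affine function
  of \<open>w = z / (1 - z)\<close>, and \<open>f z / (1 - f z) = 1 / (1 - f z) - 1\<close>. Hence composing such functions
  composes affine maps, and the generating function \<open>G\<close> of \<open>N t\<close> satisfies
  \<open>1 / (1 - G z) = S t + (\<Prod>i = 1..t. p i / \<beta> i) * w\<close>. So \<open>N t\<close> again has a linear fractional
  law, with parameters \<open>\<rho> t\<close> and \<open>\<pi> t\<close> in the roles of \<open>p\<close> and \<open>\<alpha>\<close>.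
\<close>

section \<open>Power series and the generating function of a linear fractional law\<close>

lemma powser_coeffs_unique:
  fixes a b :: "nat \<Rightarrow> real"
  assumes a: "\<And>z. \<bar>z\<bar> < 1 \<Longrightarrow> (\<lambda>k. a k * z ^ k) sums F z"
    and b: "\<And>z. \<bar>z\<bar> < 1 \<Longrightarrow> (\<lambda>k. b k * z ^ k) sums F z"
  shows "a k = b k"
proof (induction k rule: less_induct)
  case (less k)
  define c where "c i = a i - b i" for i
  have c0: "c i = 0" if "i < k" for i
    using less that by (simp add: c_def)
  \<comment> \<open>Since the coefficients below \<open>k\<close> vanish, the difference series may
    be divided by \<open>z ^ k\<close>. The quotient vanishes for small nonzero \<open>z\<close>,
    and its limit at 0 is its constant term \<open>c k\<close>.\<close>
  have "(\<lambda>i. c (i + k) * z ^ i) sums 0" if z: "z \<noteq> 0" "norm z < 1" for z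
  proof -
    have "(\<lambda>i. c i * z ^ i) sums 0"
      using sums_diff[OF a b, of z z] z by (simp add: c_def algebra_simps)
    then have "(\<lambda>i. c (i + k) * z ^ (i + k)) sums 0"
      using c0 by (subst sums_iff_shift) simp
    from sums_divide[OF this, of "z ^ k"] show ?thesis
      using z by (simp add: power_add)
  qed
  then have "((\<lambda>_. 0) \<longlongrightarrow> c (0 + k)) (at (0::real))"
    by (intro powser_limit_0_strong[of 1 "\<lambda>i. c (i + k)"]) auto
  then have "c k = 0"
    by (simp add: tendsto_const_iff)
  then show ?case
    by (simp add: c_def)
qed

lemma offspring_prob_gf:
  assumes "0 < p t" "p t \<le> 1" "\<bar>z\<bar> < 1"
  shows "(\<lambda>k. offspring_prob p \<alpha> t k * z ^ k) sums
    (\<alpha> t + (1 - \<alpha> t) * p t * z / (1 - (1 - p t) * z))"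
proof -
  have "\<bar>(1 - p t) * z\<bar> \<le> 1 * \<bar>z\<bar>"
    unfolding abs_mult using assms by (intro mult_right_mono) auto
  then have "(\<lambda>k. (1 - \<alpha> t) * p t * z * ((1 - p t) * z) ^ k) sums
      ((1 - \<alpha> t) * p t * z * (1 / (1 - (1 - p t) * z)))"
    using assms by (intro sums_mult geometric_sums) auto
  then have "(\<lambda>k. offspring_prob p \<alpha> t (Suc k) * z ^ Suc k) sums
      ((1 - \<alpha> t) * p t * z / (1 - (1 - p t) * z))"
    by (simp add: offspring_prob_def power_mult_distrib mult_ac)
  from sums_Suc[OF this] show ?thesis
    by (simp add: offspring_prob_def add.commute)
qed

text \<open>Splits an expectation according to the value of \<open>N\<close>. The partial sums are
  the integrals of \<open>h\<close> over \<open>N < n\<close>; they converge by dominated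
  convergence with bound \<open>\<bar>h\<bar>\<close>.\<close>

lemma sums_integral_fibers:
  fixes h :: "'a \<Rightarrow> real"
  assumes h: "integrable M h" and N[measurable]: "N \<in> measurable M (count_space UNIV)"
  shows "(\<lambda>n. \<integral>\<omega>. h \<omega> * indicator {n::nat} (N \<omega>) \<partial>M) sums (\<integral>\<omega>. h \<omega> \<partial>M)"
proof -
  note [measurable] = borel_measurable_integrable[OF h]
  have int: "integrable M (\<lambda>\<omega>. h \<omega> * indicator {n} (N \<omega>))" for n
  proof (rule Bochner_Integration.integrable_bound[OF h])
    show "(\<lambda>\<omega>. h \<omega> * indicator {n} (N \<omega>)) \<in> borel_measurable M"
      by (intro borel_measurable_times measurable_compose[OF N]) auto
  qed (auto split: split_indicator)
  have sum_ind: "(\<Sum>i<n. h \<omega> * indicator {i} (N \<omega>)) = h \<omega> * indicator {..<n} (N \<omega>)" for n \<omega>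
    by (simp add: indicator_def sum.If_cases sum_distrib_left[symmetric])
  have "(\<lambda>n. \<integral>\<omega>. (\<Sum>i<n. h \<omega> * indicator {i} (N \<omega>)) \<partial>M) \<longlonglongrightarrow> (\<integral>\<omega>. h \<omega> \<partial>M)"
    unfolding sum_ind
  proof (rule integral_dominated_convergence[where w = "\<lambda>\<omega>. \<bar>h \<omega>\<bar>"])
    show "AE \<omega> in M. (\<lambda>n. h \<omega> * indicator {..<n} (N \<omega>)) \<longlonglongrightarrow> h \<omega>"
    proof (intro AE_I2 tendsto_eventually)
      fix \<omega>
      show "\<forall>\<^sub>F n in sequentially. h \<omega> * indicator {..<n} (N \<omega>) = h \<omega>"
        using eventually_gt_at_top[of "N \<omega>"] by eventually_elim simp
    qed
    show "(\<lambda>\<omega>. h \<omega> * indicator {..<n} (N \<omega>)) \<in> borel_measurable M" for n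
      by (intro borel_measurable_times measurable_compose[OF N]) auto
  qed (use h in \<open>auto split: split_indicator\<close>)
  then show ?thesis
    by (simp only: sums_def Bochner_Integration.integral_sum[OF int])
qed

section \<open>Generating functions of random variables and of random sums\<close>

context prob_space
begin

lemma integrable_power_nat_rv:
  fixes z :: real and X :: "'a \<Rightarrow> nat"
  assumes [measurable]: "X \<in> measurable M (count_space UNIV)" and "\<bar>z\<bar> \<le> 1"
  shows "integrable M (\<lambda>\<omega>. z ^ X \<omega>)"
  by (rule integrable_const_bound[where B = 1])
     (use assms(2) in \<open>auto simp: power_abs power_le_one\<close>)

lemma abs_expectation_power_le_1:
  fixes z :: real and X :: "'a \<Rightarrow> nat"
  assumes "X \<in> measurable M (count_space UNIV)" and "\<bar>z\<bar> \<le> 1"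
  shows "\<bar>expectation (\<lambda>\<omega>. z ^ X \<omega>)\<bar> \<le> 1"
proof -
  have "\<bar>expectation (\<lambda>\<omega>. z ^ X \<omega>)\<bar> \<le> expectation (\<lambda>\<omega>. \<bar>z ^ X \<omega>\<bar>)"
    by (rule integral_abs_bound)
  also have "\<dots> \<le> 1"
    using assms
    by (intro integral_le_const integrable_abs integrable_power_nat_rv)
       (auto simp: power_abs power_le_one)
  finally show ?thesis .
qed

text \<open>The fibers of \<open>X\<close> itself are used. The boundary case
  \<open>\<bar>z\<bar> = 1\<close> is included because the lemma is later applied at
  \<open>g\<close>, an expectation of powers, of which only \<open>\<bar>g\<bar> \<le> 1\<close> is
  known.\<close>

lemma expectation_power_sums:
  fixes z :: real and X :: "'a \<Rightarrow> nat"
  assumes X[measurable]: "X \<in> measurable M (count_space UNIV)" and z: "\<bar>z\<bar> \<le> 1"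
  shows "(\<lambda>k. \<P>(\<omega> in M. X \<omega> = k) * z ^ k) sums expectation (\<lambda>\<omega>. z ^ X \<omega>)"
proof -
  have "expectation (\<lambda>\<omega>. z ^ X \<omega> * indicator {k} (X \<omega>)) = \<P>(\<omega> in M. X \<omega> = k) * z ^ k" for k
  proof -
    have "expectation (\<lambda>\<omega>. z ^ X \<omega> * indicator {k} (X \<omega>)) =
        expectation (\<lambda>\<omega>. z ^ k * indicator {\<omega> \<in> space M. X \<omega> = k} \<omega>)"
      by (intro Bochner_Integration.integral_cong) (auto split: split_indicator)
    then show ?thesis
      by simp
  qed
  then show ?thesis
    using sums_integral_fibers[OF integrable_power_nat_rv[OF X z] X] by simp
qed

text \<open>On \<open>N = n\<close> the power is a product of \<open>n\<close> independent factors
  of mean \<open>g\<close>, which are also independent of \<open>N\<close>; the fiber thus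
  contributes P(N = n) times \<open>g ^ n\<close>, and summing over \<open>n\<close> gives the
  result. Placing \<open>N\<close> at index 0 lets one independence assumption cover
  \<open>N\<close> and all summands.\<close>

lemma expectation_power_random_sum:
  fixes z :: real and N :: "'a \<Rightarrow> nat" and X :: "nat \<Rightarrow> 'a \<Rightarrow> nat"
  assumes ind: "indep_vars (\<lambda>_. count_space UNIV) (\<lambda>i. if i = 0 then N else X i) UNIV"
    and gf: "\<And>i. i \<ge> 1 \<Longrightarrow> expectation (\<lambda>\<omega>. z ^ X i \<omega>) = g"
    and z: "\<bar>z\<bar> \<le> 1"
  shows "expectation (\<lambda>\<omega>. z ^ (\<Sum>i = 1..N \<omega>. X i \<omega>)) = expectation (\<lambda>\<omega>. g ^ N \<omega>)"
proof -
  have rv: "(if i = 0 then N else X i) \<in> measurable M (count_space UNIV)" for i :: nat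
    using ind by (auto simp: indep_vars_def)
  have N[measurable]: "N \<in> measurable M (count_space UNIV)"
    using rv[of 0] by simp
  have X[measurable]: "X i \<in> measurable M (count_space UNIV)" if "i \<ge> 1" for i
    using rv[of i] that by simp
  have g: "\<bar>g\<bar> \<le> 1"
    using abs_expectation_power_le_1[OF X[of 1] z] gf[of 1] by simp
  have "(\<lambda>\<omega>. \<Sum>i = 1..n. X i \<omega>) \<in> measurable M (count_space UNIV)" for n
    by (intro measurable_sum_nat) auto
  then have sum_rv: "(\<lambda>\<omega>. \<Sum>i = 1..N \<omega>. X i \<omega>) \<in> measurable M (count_space UNIV)"
    by (rule measurable_compose_countable) (rule N)
  have "expectation (\<lambda>\<omega>. z ^ (\<Sum>i = 1..N \<omega>. X i \<omega>) * indicator {n} (N \<omega>)) =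
      \<P>(\<omega> in M. N \<omega> = n) * g ^ n" for n
  proof -
    \<comment> \<open>The factor at index 0 is the indicator of \<open>N = n\<close>, so the product
      of \<open>Y 0\<close>, ..., \<open>Y n\<close> is the integrand cut off to this fiber, with a
      fixed number of factors.\<close>
    define h :: "nat \<Rightarrow> nat \<Rightarrow> real" where "h i m = (if i = 0 then indicator {n} m else z ^ m)" for i m
    define Y where "Y i \<omega> = h i ((if i = 0 then N else X i) \<omega>)" for i \<omega>
    have ind_Y: "indep_vars (\<lambda>_. borel) Y {..n}"
      unfolding Y_def
      by (rule indep_vars_compose2[OF indep_vars_subset[OF ind]]) auto
    have int_Y: "integrable M (Y i)" for i
    proof (rule integrable_const_bound[where B = 1])
      show "Y i \<in> borel_measurable M"
        unfolding Y_def using rv[of i] by measurable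
      show "AE \<omega> in M. norm (Y i \<omega>) \<le> 1"
        using z by (auto simp: Y_def h_def power_abs power_le_one split: split_indicator)
    qed
    have split_0: "prod f {..n} = f 0 * prod f {1..n}" for f :: "nat \<Rightarrow> real"
      by (simp add: atMost_atLeast0 prod.atLeast_Suc_atMost)
    have "expectation (\<lambda>\<omega>. z ^ (\<Sum>i = 1..N \<omega>. X i \<omega>) * indicator {n} (N \<omega>)) =
        expectation (\<lambda>\<omega>. \<Prod>i\<le>n. Y i \<omega>)"
      by (intro Bochner_Integration.integral_cong)
         (auto simp: split_0 Y_def h_def power_sum split: split_indicator)
    also have "\<dots> = (\<Prod>i\<le>n. expectation (Y i))"
      by (intro indep_vars_lebesgue_integral ind_Y int_Y) auto
    also have "\<dots> = expectation (Y 0) * (\<Prod>i = 1..n. g)"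
      unfolding split_0 using gf by (intro arg_cong2[where f = "(*)"] prod.cong)
         (auto simp: Y_def[abs_def] h_def)
    also have "expectation (Y 0) = expectation (indicator {\<omega> \<in> space M. N \<omega> = n})"
      by (intro Bochner_Integration.integral_cong) (auto simp: Y_def h_def split: split_indicator)
    finally show ?thesis
      by simp
  qed
  then have "(\<lambda>n. \<P>(\<omega> in M. N \<omega> = n) * g ^ n) sums expectation (\<lambda>\<omega>. z ^ (\<Sum>i = 1..N \<omega>. X i \<omega>))"
    using sums_integral_fibers[OF integrable_power_nat_rv[OF sum_rv z] N] by simp
  then show ?thesis
    using expectation_power_sums[OF N g] by (rule sums_unique2)
qed

end

section \<open>Measurability of the process and independence of successive generations\<close>

lemma measurable_gw_process:
  assumes "\<And>s i. s \<in> {1..t} \<Longrightarrow> i \<ge> 1 \<Longrightarrow> \<xi> s i \<in> measurable M (count_space UNIV)"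
  shows "gw_process \<xi> t \<in> measurable M (count_space UNIV)"
  using assms
proof (induction t)
  case 0
  have "gw_process \<xi> 0 = (\<lambda>_. 1)"
    by auto
  then show ?case
    by simp
next
  case (Suc t)
  \<comment> \<open>The number of summands is random but takes countably many values, so a fixed
    number \<open>n\<close> suffices.\<close>
  have "(\<lambda>\<omega>. \<Sum>i = 1..n. \<xi> (Suc t) i \<omega>) \<in> measurable M (count_space UNIV)" for n
    using Suc.prems by (intro measurable_sum_nat) auto
  moreover have "gw_process \<xi> t \<in> measurable M (count_space UNIV)"
    using Suc.prems by (intro Suc.IH) auto
  ultimately show ?case
    by (simp add: measurable_compose_countable)
qed

text \<open>Two sample points are allowed because the process driven by \<open>\<xi>\<close> is
  compared with one driven by the coordinate maps of a product space, which agree with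
  \<open>\<xi>\<close> only on generations up to \<open>t\<close>.\<close>

lemma gw_process_cong:
  assumes "\<And>s i. s \<in> {1..t} \<Longrightarrow> i \<ge> 1 \<Longrightarrow> \<xi> s i \<omega> = \<eta> s i x"
  shows "gw_process \<xi> t \<omega> = gw_process \<eta> t x"
  using assms by (induction t) auto

lemma (in prob_space) indep_vars_gw_process:
  assumes ind: "indep_vars (\<lambda>_. count_space UNIV) (\<lambda>(t, i). \<xi> t i) ({1..} \<times> {1..})"
  shows "indep_vars (\<lambda>_. count_space UNIV)
    (\<lambda>i. if i = 0 then gw_process \<xi> t else \<xi> (Suc t) i) UNIV"
proof -
  \<comment> \<open>The index set is cut into disjoint blocks: all of generations 1 to
    \<open>t\<close>, which determine the process at time \<open>t\<close>, and one singleton for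
    each offspring variable of generation \<open>Suc t\<close>. The maps \<open>\<Phi>\<close>
    recover the variables from their blocks.\<close>
  define K where "K j = (if j = 0 then {1..t} \<times> {1..} else {(Suc t, j)})" for j :: nat
  define \<Phi> :: "nat \<Rightarrow> (nat \<times> nat \<Rightarrow> nat) \<Rightarrow> nat"
    where "\<Phi> j = (if j = 0 then gw_process (\<lambda>s i x. x (s, i)) t else (\<lambda>x. x (Suc t, j)))" for j
  have "indep_vars (\<lambda>j. PiM (K j) (\<lambda>_. count_space UNIV))
      (\<lambda>j \<omega>. restrict (\<lambda>i. (case i of (t, i) \<Rightarrow> \<xi> t i) \<omega>) (K j)) UNIV"
    by (rule indep_vars_restrict[OF ind]) (auto simp: K_def disjoint_family_on_def)
  moreover have "\<Phi> j \<in> measurable (PiM (K j) (\<lambda>_. count_space UNIV)) (count_space UNIV)" for j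
    by (auto simp: \<Phi>_def K_def intro!: measurable_gw_process measurable_component_singleton)
  ultimately have "indep_vars (\<lambda>_. count_space UNIV)
      (\<lambda>j \<omega>. \<Phi> j (restrict (\<lambda>i. (case i of (t, i) \<Rightarrow> \<xi> t i) \<omega>) (K j))) UNIV"
    by (rule indep_vars_compose2)
  also have "(\<lambda>j \<omega>. \<Phi> j (restrict (\<lambda>i. (case i of (t, i) \<Rightarrow> \<xi> t i) \<omega>) (K j))) =
      (\<lambda>i. if i = 0 then gw_process \<xi> t else \<xi> (Suc t) i)"
    by (auto simp: \<Phi>_def K_def fun_eq_iff intro!: gw_process_cong)
  finally show ?thesis .
qed

section \<open>Bounds on the environment and algebra of linear fractional maps\<close>

lemma prod_env_bounds:
  assumes p: "\<And>s. s \<ge> 1 \<Longrightarrow> 0 < p s \<and> p s < 1"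
    and \<alpha>: "\<And>s. s \<ge> 1 \<Longrightarrow> 0 < \<alpha> s \<and> \<alpha> s < 1"
  shows "0 < (\<Prod>i = 1..t. p i / beta \<alpha> i)" "(\<Prod>i = 1..t. p i / beta \<alpha> i) \<le> S_env p \<alpha> t"
proof -
  have pos: "0 < p s / beta \<alpha> s" if "s \<ge> 1" for s
    using p[OF that] \<alpha>[OF that] by (simp add: beta_def)
  then show P_pos: "0 < (\<Prod>i = 1..t. p i / beta \<alpha> i)" for t
    by (intro prod_pos) auto
  show "(\<Prod>i = 1..t. p i / beta \<alpha> i) \<le> S_env p \<alpha> t"
  proof (induction t)
    case (Suc t)
    \<comment> \<open>As \<open>p (Suc t) < 1\<close>, the increase of the product is at most the
      old product times (1 - \<beta>) / \<beta>, which is exactly the new summand of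
      \<open>S_env\<close>.\<close>
    have "p (Suc t) / beta \<alpha> (Suc t) \<le> 1 / beta \<alpha> (Suc t)"
      using p[of "Suc t"] \<alpha>[of "Suc t"] by (intro divide_right_mono) (auto simp: beta_def)
    also have "\<dots> = 1 + (1 - beta \<alpha> (Suc t)) / beta \<alpha> (Suc t)"
      using \<alpha>[of "Suc t"] by (simp add: beta_def field_simps)
    finally have "p (Suc t) / beta \<alpha> (Suc t) \<le> 1 + (1 - beta \<alpha> (Suc t)) / beta \<alpha> (Suc t)" .
    from mult_left_mono[OF this less_imp_le[OF P_pos[of t]]] Suc.IH show ?case
      by (simp add: S_env_def atLeastLessThanSuc_atLeastAtMost algebra_simps)
  qed (simp add: S_env_def)
qed

lemma rho_env_bounds:
  assumes "\<And>s. s \<ge> 1 \<Longrightarrow> 0 < p s \<and> p s < 1"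
    and "\<And>s. s \<ge> 1 \<Longrightarrow> 0 < \<alpha> s \<and> \<alpha> s < 1"
  shows "0 < rho_env p \<alpha> t" "rho_env p \<alpha> t \<le> 1"
  using prod_env_bounds[of p \<alpha> t, OF assms] by (auto simp: rho_env_def)

text \<open>Both sides are the function G with 1 / (1 - G) = S + P z / (1 - z). The right side is
  the form that composes easily, the left side the one whose coefficients are known.\<close>

lemma linear_fractional_gf_eq:
  fixes z S P :: real
  assumes "0 < P" "P \<le> S" "\<bar>z\<bar> < 1"
  shows "(1 - 1 / S) + (1 - (1 - 1 / S)) * (1 / S * P) * z / (1 - (1 - 1 / S * P) * z) =
    1 - (1 - z) / (S * (1 - z) + P * z)"
proof -
  \<comment> \<open>Adding \<open>P * z\<close> turns the left side into \<open>P > 0\<close>, so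
    the denominator is positive.\<close>
  have "P * (1 - z) \<le> S * (1 - z)"
    using assms by (intro mult_right_mono) auto
  then have pos: "0 < S * (1 - z) + P * z"
    using assms by (simp add: algebra_simps)
  have "1 - (1 - 1 / S * P) * z = (S * (1 - z) + P * z) / S"
    using assms by (simp add: field_simps)
  then show "(1 - 1 / S) + (1 - (1 - 1 / S)) * (1 / S * P) * z / (1 - (1 - 1 / S * P) * z) =
    1 - (1 - z) / (S * (1 - z) + P * z)"
    using pos assms by (simp add: divide_simps) (simp add: algebra_simps)
qed

text \<open>Keeps the offspring generating function inside the disc where the induction hypothesis
  applies. The value is a convex combination, with weights \<open>a\<close> and
  \<open>1 - a\<close>, of 1 and a number of modulus below 1.\<close>

lemma linear_fractional_abs_less_1:
  fixes a p z :: real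
  assumes "0 < p" "p < 1" "0 < a" "a < 1" "\<bar>z\<bar> < 1"
  shows "\<bar>a + (1 - a) * p * z / (1 - (1 - p) * z)\<bar> < 1"
proof -
  have "(1 - p) * z \<le> (1 - p) * \<bar>z\<bar>"
    using assms by (intro mult_left_mono) auto
  moreover have "(1 - p) * \<bar>z\<bar> + p * \<bar>z\<bar> = \<bar>z\<bar>"
    by (simp add: algebra_simps)
  ultimately have "p * \<bar>z\<bar> < 1 - (1 - p) * z" and pos: "0 < 1 - (1 - p) * z"
    using assms by (smt (verit) mult_nonneg_nonneg)+
  then have "\<bar>p * z / (1 - (1 - p) * z)\<bar> < 1"
    using assms by (simp add: abs_mult)
  from mult_strict_left_mono[OF this, of "1 - a"]
  have "\<bar>(1 - a) * (p * z / (1 - (1 - p) * z))\<bar> < 1 - a"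
    using assms by (simp only: abs_mult) simp
  then show ?thesis
    using assms(3) by (simp only: mult.assoc times_divide_eq_right)
qed

text \<open>In the variable z / (1 - z) the map \<open>f\<close> is affine: f / (1 - f) = a / (1 -
  a) + (q / (1 - a)) z / (1 - z). Substituting this into S + P w gives the new constant term and
  slope.\<close>

lemma linear_fractional_compose:
  fixes a q z S P :: real
  assumes "q > 0" "q < 1" "a < 1" "\<bar>z\<bar> < 1"
  defines "f \<equiv> a + (1 - a) * q * z / (1 - (1 - q) * z)"
  shows "(1 - f) / (S * (1 - f) + P * f) =
    (1 - z) / ((S + P * (a / (1 - a))) * (1 - z) + P * (q / (1 - a)) * z)"
proof -
  define b where "b = 1 - a"
  define D where "D = 1 - (1 - q) * z"
  \<comment> \<open>The common numerator of the two denominators in the claim, which are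
    \<open>T / D\<close> and \<open>T / b\<close>.\<close>
  define T where "T = S * (b * (1 - z)) + P * (a * (1 - z) + q * z)"
  have "(1 - q) * z < (1 - q) * 1"
    using assms by (intro mult_strict_left_mono) auto
  also have "\<dots> < 1"
    using assms by simp
  finally have D: "D \<noteq> 0"
    by (simp add: D_def)
  have b: "b \<noteq> 0"
    using assms by (simp add: b_def)
  have "f = (a * D + b * q * z) / D"
    using D by (simp add: f_def b_def D_def[symmetric] add_divide_distrib)
  also have "a * D + b * q * z = a * (1 - z) + q * z"
    by (simp add: D_def b_def algebra_simps)
  finally have f: "f = (a * (1 - z) + q * z) / D" .
  have "1 - f = (D - (a * (1 - z) + q * z)) / D"
    using D by (simp add: f diff_divide_distrib)
  also have "D - (a * (1 - z) + q * z) = b * (1 - z)"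
    by (simp add: D_def b_def algebra_simps)
  finally have f1: "1 - f = b * (1 - z) / D" .
  have "S * (1 - f) + P * f = T / D"
    unfolding f1 unfolding f by (simp only: T_def times_divide_eq_right add_divide_distrib[symmetric])
  moreover have "(S + P * (a / b)) * (1 - z) + P * (q / b) * z = T / b"
    using b by (simp add: T_def divide_simps) (simp add: algebra_simps)
  ultimately show ?thesis
    using D b by (simp add: f1 b_def[symmetric])
qed

text \<open>By the random sum formula, the generating function at time \<open>Suc t\<close> is the
  one at time \<open>t\<close> evaluated at \<open>f\<close>, the offspring generating function at
  \<open>z\<close>. Hence \<open>z\<close> is kept arbitrary in the induction.\<close>

lemma gw_process_gf:
  fixes M :: "'a measure"
  assumes M: "prob_space M"
    and p: "\<And>s. s \<ge> 1 \<Longrightarrow> 0 < p s \<and> p s < 1"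
    and \<alpha>: "\<And>s. s \<ge> 1 \<Longrightarrow> 0 < \<alpha> s \<and> \<alpha> s < 1"
    and fam: "offspring_family M p \<alpha> \<xi>"
    and z: "\<bar>z\<bar> < 1"
  shows "(\<integral>\<omega>. z ^ gw_process \<xi> t \<omega> \<partial>M) =
    1 - (1 - z) / (S_env p \<alpha> t * (1 - z) + (\<Prod>i = 1..t. p i / beta \<alpha> i) * z)"
  using z
proof (induction t arbitrary: z)
  case 0
  interpret prob_space M by (rule M)
  show ?case
    by (simp add: S_env_def prob_space)
next
  case (Suc t)
  interpret prob_space M by (rule M)
  have ind: "indep_vars (\<lambda>_. count_space UNIV) (\<lambda>(t, i). \<xi> t i) ({1..} \<times> {1..})"
    and law: "\<And>t i k. t \<ge> 1 \<Longrightarrow> i \<ge> 1 \<Longrightarrow> \<P>(\<omega> in M. \<xi> t i \<omega> = k) = offspring_prob p \<alpha> t k"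
    using fam by (auto simp: offspring_family_def)
  define a q where "a = \<alpha> (Suc t)" and "q = p (Suc t)"
  have aq: "0 < a" "a < 1" "0 < q" "q < 1"
    using p \<alpha> by (auto simp: a_def q_def)
  define f where "f = a + (1 - a) * q * z / (1 - (1 - q) * z)"
  have f_less: "\<bar>f\<bar> < 1"
    unfolding f_def using aq Suc.prems by (intro linear_fractional_abs_less_1)
  define S P where "S = S_env p \<alpha> t" and "P = (\<Prod>i = 1..t. p i / beta \<alpha> i)"
  have SP: "0 < P" "P \<le> S"
    using prod_env_bounds[of p \<alpha> t, OF p \<alpha>] by (auto simp: S_def P_def)
  have "expectation (\<lambda>\<omega>. z ^ \<xi> (Suc t) i \<omega>) = f" if "i \<ge> 1" for i
  proof -
    have "\<xi> (Suc t) i \<in> measurable M (count_space UNIV)"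
      using ind that by (auto simp: indep_vars_def)
    then have "(\<lambda>k. offspring_prob p \<alpha> (Suc t) k * z ^ k) sums
        expectation (\<lambda>\<omega>. z ^ \<xi> (Suc t) i \<omega>)"
      using expectation_power_sums[of "\<xi> (Suc t) i" z] Suc.prems that by (simp add: law)
    moreover have "(\<lambda>k. offspring_prob p \<alpha> (Suc t) k * z ^ k) sums f"
      using offspring_prob_gf[of p "Suc t" z \<alpha>] aq Suc.prems by (simp add: f_def a_def q_def)
    ultimately show ?thesis
      by (rule sums_unique2)
  qed
  then have "expectation (\<lambda>\<omega>. z ^ gw_process \<xi> (Suc t) \<omega>) = expectation (\<lambda>\<omega>. f ^ gw_process \<xi> t \<omega>)"
    using expectation_power_random_sum[OF indep_vars_gw_process[OF ind, of t], of z f] Suc.prems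
    by simp
  also have "expectation (\<lambda>\<omega>. f ^ gw_process \<xi> t \<omega>) = 1 - (1 - f) / (S * (1 - f) + P * f)"
    unfolding S_def P_def by (rule Suc.IH[OF f_less])
  also have "(1 - f) / (S * (1 - f) + P * f) =
      (1 - z) / ((S + P * (a / (1 - a))) * (1 - z) + P * (q / (1 - a)) * z)"
    unfolding f_def using aq Suc.prems by (intro linear_fractional_compose)
  \<comment> \<open>The product in the summand of index \<open>Suc t\<close> stops at
    \<open>t\<close>, so it is \<open>P\<close>, and \<open>a / (1 - a)\<close> is (1 - \<beta>) /
    \<beta>.\<close>
  also have "S + P * (a / (1 - a)) = S_env p \<alpha> (Suc t)"
    by (simp add: S_env_def S_def P_def a_def beta_def atLeastLessThanSuc_atLeastAtMost)
  also have "P * (q / (1 - a)) = (\<Prod>i = 1..Suc t. p i / beta \<alpha> i)"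
    by (simp add: P_def a_def q_def beta_def)
  finally show ?case .
qed

theorem theorem2p1:
  fixes M :: "'a measure" and p \<alpha> :: "nat \<Rightarrow> real"
    and \<xi> :: "nat \<Rightarrow> nat \<Rightarrow> 'a \<Rightarrow> nat" and t k :: nat
  assumes "prob_space M"
    and "\<And>s. s \<ge> 1 \<Longrightarrow> 0 < p s \<and> p s < 1"
    and "\<And>s. s \<ge> 1 \<Longrightarrow> 0 < \<alpha> s \<and> \<alpha> s < 1"
    and "offspring_family M p \<alpha> \<xi>"
    and "t \<ge> 1" and "k \<ge> 1"
  shows "\<P>(\<omega> in M. gw_process \<xi> t \<omega> = k) =
    (1 - pi_env p \<alpha> t) * rho_env p \<alpha> t * (1 - rho_env p \<alpha> t) ^ (k - 1)"
proof -
  interpret prob_space M by (rule assms(1))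
  note env = assms(2,3)
  have rv: "gw_process \<xi> t \<in> measurable M (count_space UNIV)"
    using assms(4) by (intro measurable_gw_process) (auto simp: offspring_family_def indep_vars_def)
  \<comment> \<open>Taking \<open>rho_env\<close> and \<open>pi_env\<close> as the parameters of an
    offspring law makes \<open>offspring_prob_gf\<close> available for the target law. Its constant
    coefficient is \<open>pi_env\<close>, and the claim is its branch
    \<open>k \<ge> 1\<close>.\<close>
  have "\<P>(\<omega> in M. gw_process \<xi> t \<omega> = k) = offspring_prob (rho_env p \<alpha>) (pi_env p \<alpha>) t k"
  proof (rule powser_coeffs_unique)
    fix z :: real
    assume z: "\<bar>z\<bar> < 1"
    then show "(\<lambda>k. \<P>(\<omega> in M. gw_process \<xi> t \<omega> = k) * z ^ k) sums
        expectation (\<lambda>\<omega>. z ^ gw_process \<xi> t \<omega>)"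
      by (intro expectation_power_sums rv) simp
    have "expectation (\<lambda>\<omega>. z ^ gw_process \<xi> t \<omega>) =
        pi_env p \<alpha> t + (1 - pi_env p \<alpha> t) * rho_env p \<alpha> t * z / (1 - (1 - rho_env p \<alpha> t) * z)"
      using linear_fractional_gf_eq[OF prod_env_bounds[of p \<alpha> t, OF env] z]
        gw_process_gf[of M p \<alpha> \<xi> z t, OF assms(1) env assms(4) z]
      unfolding pi_env_def rho_env_def by simp
    then show "(\<lambda>k. offspring_prob (rho_env p \<alpha>) (pi_env p \<alpha>) t k * z ^ k) sums
        expectation (\<lambda>\<omega>. z ^ gw_process \<xi> t \<omega>)"
      using offspring_prob_gf[of "rho_env p \<alpha>" t z "pi_env p \<alpha>"] rho_env_bounds[of p \<alpha> t] env z
      by simp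
  qed
  then show ?thesis
    using assms(6) by (simp add: offspring_prob_def)
qed

end
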